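(* For all integers $r\geq 1$, we have \[ f_r(2)\geq \frac{4^r}{2}; \] and, for all integers $k\geq 3$ and $r\geq 1$, we have \[ f_r(k)\geq (2^r-1)k^r. \]
   Context: For integers $k\geq 2$ and $r\geq 1$, $f_r(k)$ denotes the smallest positive integer $n$ such that every $r$-coloring of $\{1,2,\ldots,n\}$ (i.e. every map $\Delta:\{1,\ldots,n\}\to\{1,\ldots,r\}$) has a monochromatic solution to the equation \[ \frac{1}{x_1}+\frac{1}{x_2}+\cdots+\frac{1}{x_k}=\frac{1}{x_{k+1}}, \] that is, there are $x_1,\ldots,x_{k+1}\in\{1,\ldots,n\}$ satisfying the equation and all having the same color; $x_1,\ldots,x_k$ are not necessarily distinct. It is known (Brown–Rödl, Lefmann) that such an $n$ exists for all $k\geq 2$ and $r\geq 1$, so $f_r(k)$ is well defined. *)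

theory Defs
  imports Complex_Main "HOL-Library.FuncSet"
begin

definition has_mono_solution :: "nat \<Rightarrow> nat \<Rightarrow> (nat \<Rightarrow> nat) \<Rightarrow> bool" where
  "has_mono_solution k n \<Delta> \<longleftrightarrow>
     (\<exists>x :: nat \<Rightarrow> nat.
        (\<forall>i\<in>{1..k+1}. x i \<in> {1..n}) \<and>
        (\<Sum>i=1..k. 1 / real (x i)) = 1 / real (x (k+1)) \<and>
        (\<exists>c. \<forall>i\<in>{1..k+1}. \<Delta> (x i) = c))"

text \<open>The minimum is attained for all \<open>k \<ge> 2\<close> and \<open>r \<ge> 1\<close> by the theorem of
  Brown--Roedl and Lefmann; outside that range the value carries no meaning.\<close>

definition unit_frac_rado :: "nat \<Rightarrow> nat \<Rightarrow> nat" where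
  "unit_frac_rado r k = (LEAST n. n > 0 \<and> (\<forall>\<Delta> \<in> {1..n} \<rightarrow> {1..r}. has_mono_solution k n \<Delta>))"

end

theory Submission
  imports Defs "HOL-Library.Ramsey"
begin

text \<open>Each colour class is the union of a long interval \<open>[m, km)\<close> and a short interval \<open>[a, b]\<close>
  with \<open>b \<le> 2a\<close> and \<open>m\<close> much larger than \<open>b\<close>. For \<open>k \<ge> 3\<close> the short intervals
  \<open>[2^j - 1, 2^(j+1) - 2]\<close>, \<open>j < r\<close>, exhaust the numbers below \<open>M = 2^r - 1\<close>, and the long
  ones, \<open>[M k^j, M k^(j+1))\<close>, cover the rest up to \<open>M k^r\<close>. For \<open>k = 2\<close> two terms \<open>1/(2a)\<close> add
  up to \<open>1/a\<close>, so the short intervals must be taken to be dyadic, and \<open>M = 2^(r-1)\<close>.\<close>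

section \<open>Existence of the Rado number\<close>

text \<open>Solutions of the linear equation \<open>y\<^sub>1 + \<dots> + y\<^sub>k = y\<^sub>k\<^sub>+\<^sub>1\<close> in \<open>{1..N}\<close> yield solutions of the
  reciprocal equation via \<open>y \<mapsto> N!/y\<close>. Ramsey's theorem for edges coloured by the difference of
  their endpoints gives a monochromatic one, made of consecutive differences in a clique.
  Without this, \<open>LEAST\<close> in the definition of \<open>unit_frac_rado\<close> would be unspecified.\<close>
lemma exists_rado_number:
  assumes "k \<ge> 1"
  shows "\<exists>n>0. \<forall>\<Delta>\<in>{1..n} \<rightarrow> {1..r}. has_mono_solution k n \<Delta>"
proof -
  obtain N :: nat where N: "partn_lst {..<N} (replicate r (Suc k)) 2"
    using ramsey_full by blast
  define L where "L = (fact N :: nat)"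
  have L: "L > 0" by (simp add: L_def)
  have dvd: "d dvd L" if "0 < d" "d \<le> N" for d
    using that by (simp add: L_def dvd_fact)
  have bound: "L div d \<in> {1..L}" if "0 < d" "d \<le> N" for d
    using dvd[OF that] L that by (auto simp: Suc_le_eq div_greater_zero_iff dvd_imp_le)
  have recip: "1 / real (L div d) = real d / real L" if "0 < d" "d \<le> N" for d
    using dvd[OF that] L that by (auto simp: real_of_nat_div)
  show ?thesis
  proof (intro exI[of _ L] conjI ballI L)
    fix \<Delta> assume \<Delta>: "\<Delta> \<in> {1..L} \<rightarrow> {1..r}"
    \<comment> \<open>The shift by 1 moves colours from \<open>{1..r}\<close> to the
      \<open>{..<r}\<close> of the partition relation. It loses nothing, since all colours that
      occur are positive.\<close>
    define f where "f e = \<Delta> (L div (Max e - Min e)) - 1" for e :: "nat set"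
    have f_eq: "f {u,v} = \<Delta> (L div (v - u)) - 1" if "u < v" for u v
      using that by (simp add: f_def max_def min_def)
    have \<Delta>_pos: "1 \<le> \<Delta> (L div (v - u)) \<and> \<Delta> (L div (v - u)) \<le> r" if "u < v" "v < N" for u v
      using \<Delta> bound[of "v - u"] that by (auto simp: Pi_iff)
    have "f \<in> [{..<N}]\<^bsup>2\<^esup> \<rightarrow> {..<r}"
    proof
      fix e assume "e \<in> [{..<N}]\<^bsup>2\<^esup>"
      then obtain u v where uv: "e = {u,v}" "u < v" "v < N"
        by (auto simp: ordered_nsets_2_eq)
      show "f e \<in> {..<r}"
        using \<Delta>_pos[OF uv(2,3)] by (simp add: uv(1) f_eq[OF uv(2)]) linarith
    qed
    then obtain c H where c: "c < r" and H: "H \<in> [{..<N}]\<^bsup>Suc k\<^esup>" and mono: "f ` [H]\<^bsup>2\<^esup> \<subseteq> {c}"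
      using partn_lstE[OF N] by (metis length_replicate nth_replicate)
    have fin: "finite H" "card H = Suc k" and HN: "H \<subseteq> {..<N}"
      using H by (auto simp: nsets_def)
    obtain h where hmono: "strict_mono_on {..<Suc k} h" and hH: "\<And>i. i < Suc k \<Longrightarrow> h i \<in> H"
      using finite_enumerate[OF fin(1)] fin(2) by metis
    have hN: "h i < N" if "i \<le> k" for i
      using hH[of i] HN that by auto
    have hless: "h i < h j" if "i < j" "j \<le> k" for i j
      using strict_mono_onD[OF hmono] that by auto
    have colour: "\<Delta> (L div (h j - h i)) = Suc c" if "i < j" "j \<le> k" for i j
    proof -
      have "{h i, h j} \<in> [H]\<^bsup>2\<^esup>"
        using hless[OF that] hH[of i] hH[of j] that by auto
      then have "f {h i, h j} = c"
        using mono by blast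
      then show ?thesis
        using f_eq[OF hless[OF that]] \<Delta>_pos[OF hless[OF that] hN[OF that(2)]] by linarith
    qed
    \<comment> \<open>The \<open>k\<close> consecutive differences of the clique vertices
      \<open>h 0 < ... < h k\<close> telescope to \<open>h k - h 0\<close>, itself a difference of
      clique vertices and so of the same colour.\<close>
    define x where "x i = (if i = k + 1 then L div (h k - h 0) else L div (h i - h (i - 1)))" for i
    have x_diff: "\<exists>u v. u < v \<and> v \<le> k \<and> x i = L div (h v - h u)" if "i \<in> {1..k+1}" for i
    proof (cases "i = k + 1")
      case True
      then show ?thesis using assms by (intro exI[of _ 0] exI[of _ k]) (simp add: x_def)
    next
      case False
      then show ?thesis using that by (intro exI[of _ "i - 1"] exI[of _ i]) (auto simp: x_def)
    qed
    have diff: "0 < h v - h u \<and> h v - h u \<le> N" if "u < v" "v \<le> k" for u v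
      using hless[OF that] hN[OF that(2)] by linarith
    show "has_mono_solution k L \<Delta>"
      unfolding has_mono_solution_def
    proof (intro exI[of _ x] conjI ballI exI[of _ "Suc c"])
      fix i assume "i \<in> {1..k+1}"
      then obtain u v where uv: "u < v" "v \<le> k" "x i = L div (h v - h u)"
        using x_diff by blast
      show "x i \<in> {1..L}" using bound diff[OF uv(1,2)] uv(3) by simp
      show "\<Delta> (x i) = Suc c" using colour[OF uv(1,2)] uv(3) by simp
    next
      have "(\<Sum>i=1..k. 1 / real (x i)) = (\<Sum>i\<in>{Suc 0..k}. real (h i) / L - real (h (i - 1)) / L)"
      proof (rule sum.cong)
        fix i assume i: "i \<in> {Suc 0..k}"
        have "x i = L div (h i - h (i - 1))"
          using i by (simp add: x_def)
        then have "1 / real (x i) = real (h i - h (i - 1)) / L"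
          using recip[of "h i - h (i - 1)"] diff[of "i - 1" i] i by simp
        then show "1 / real (x i) = real (h i) / L - real (h (i - 1)) / L"
          using hless[of "i - 1" i] i by (simp add: of_nat_diff diff_divide_distrib)
      qed simp
      also have "\<dots> = real (h k) / L - real (h 0) / L"
        using sum_telescope''[of 0 k "\<lambda>i. real (h i) / L"] by simp
      also have "\<dots> = real (h k - h 0) / L"
        using hless[of 0 k] assms by (simp add: of_nat_diff diff_divide_distrib)
      also have "\<dots> = 1 / real (x (k + 1))"
        using recip[of "h k - h 0"] diff[of 0 k] assms by (simp add: x_def)
      finally show "(\<Sum>i=1..k. 1 / real (x i)) = 1 / real (x (k + 1))" .
    qed
  qed
qed

section \<open>Solution-free sets\<close>

text \<open>Positivity is demanded because \<open>1 / 0 = 0\<close> would let the denominator 0 take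
  part in spurious solutions; one of the sets used below contains 0.\<close>

definition unit_frac_free :: "nat \<Rightarrow> nat set \<Rightarrow> bool" where
  "unit_frac_free k A \<longleftrightarrow>
     \<not> (\<exists>x :: nat \<Rightarrow> nat. (\<forall>i\<in>{1..k+1}. 0 < x i \<and> x i \<in> A) \<and>
          (\<Sum>i=1..k. 1 / real (x i)) = 1 / real (x (k+1)))"

text \<open>If the minimum were some \<open>n < N\<close>, choosing for each number up to
  \<open>n\<close> one index of a set containing it would give a colouring without monochromatic
  solution.\<close>

lemma unit_frac_rado_ge:
  assumes "k \<ge> 1"
    and cover: "\<And>x. 0 < x \<Longrightarrow> x < N \<Longrightarrow> \<exists>j<r. x \<in> A j"
    and free: "\<And>j. j < r \<Longrightarrow> unit_frac_free k (A j)"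
  shows "N \<le> unit_frac_rado r k"
proof (rule ccontr)
  define n where "n = unit_frac_rado r k"
  assume "\<not> N \<le> unit_frac_rado r k"
  then have n: "n < N" by (simp add: n_def)
  have all: "\<forall>\<Delta>\<in>{1..n} \<rightarrow> {1..r}. has_mono_solution k n \<Delta>"
    unfolding n_def unit_frac_rado_def using LeastI_ex[OF exists_rado_number[OF assms(1), of r]] by blast
  have "\<forall>x\<in>{1..n}. \<exists>j<r. x \<in> A j"
    using cover n by auto
  then obtain g where g: "\<And>x. x \<in> {1..n} \<Longrightarrow> g x < r \<and> x \<in> A (g x)"
    by metis
  have "(\<lambda>x. Suc (g x)) \<in> {1..n} \<rightarrow> {1..r}"
    using g by (auto simp: Suc_le_eq)
  then have "has_mono_solution k n (\<lambda>x. Suc (g x))"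
    using all by blast
  then obtain x c where x: "\<And>i. i \<in> {1..k+1} \<Longrightarrow> x i \<in> {1..n}"
    and eq: "(\<Sum>i=1..k. 1 / real (x i)) = 1 / real (x (k+1))"
    and c: "\<And>i. i \<in> {1..k+1} \<Longrightarrow> Suc (g (x i)) = c"
    unfolding has_mono_solution_def by blast
  have c': "g (x i) = c - 1" if "i \<in> {1..k+1}" for i
    using c[OF that] by simp
  have "\<forall>i\<in>{1..k+1}. 0 < x i \<and> x i \<in> A (c - 1)"
    using x g c' by (metis atLeastAtMost_iff less_eq_Suc_le One_nat_def)
  moreover have "c - 1 < r"
    using g[OF x[of 1]] c'[of 1] by simp
  ultimately show False
    using free eq unfolding unit_frac_free_def by blast
qed

text \<open>Suppose the right-hand side is \<open>1/z\<close>. If \<open>z\<close> lies in the long interval, all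
  terms are too large. Otherwise count the terms with a denominator in the short interval: with
  none the sum is too small, with two or more it is too large, and with exactly one, \<open>1/w\<close>, the
  other terms cannot bridge the gap \<open>1/z - 1/w \<ge> 1/(b(b-1))\<close>.\<close>
lemma unit_frac_free_two_intervals:
  assumes k: "k \<ge> 2" and b: "b \<le> 2 * a" and strict: "k \<ge> 3 \<or> b < 2 * a"
    and kb: "k * b < m" and gap: "b * (b - 1) * (k - 1) < m"
  shows "unit_frac_free k ({a..b} \<union> {m..<k * m})"
  unfolding unit_frac_free_def
proof
  assume "\<exists>x :: nat \<Rightarrow> nat. (\<forall>i\<in>{1..k+1}. 0 < x i \<and> x i \<in> {a..b} \<union> {m..<k * m}) \<and>
          (\<Sum>i=1..k. 1 / real (x i)) = 1 / real (x (k+1))"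
  then obtain x :: "nat \<Rightarrow> nat" where pos: "\<And>i. i \<in> {1..k+1} \<Longrightarrow> 0 < x i"
    and mem: "\<And>i. i \<in> {1..k+1} \<Longrightarrow> x i \<in> {a..b} \<union> {m..<k * m}"
    and eq: "(\<Sum>i=1..k. 1 / real (x i)) = 1 / real (x (k+1))"
    by blast
  define z where "z = x (k + 1)"
  have z: "0 < z" "z \<in> {a..b} \<union> {m..<k * m}"
    using pos[of "k+1"] mem[of "k+1"] by (auto simp: z_def)
  have m: "0 < m" using kb by simp
  have bm: "b < m"
    using kb k by (metis le_square mult_le_mono1 le_trans nat_mult_1 not_less one_le_numeral order.trans)
  have mkm: "m \<le> k * m" using k by simp
  have upper: "1 / real (x i) \<le> 1 / m" if "i \<in> {1..k}" "x i \<notin> {a..b}" for i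
    using mem[of i] pos[of i] that m by (auto simp: frac_le)
  have lower: "1 / real b \<le> 1 / real (x i)" if "i \<in> {1..k}" "x i \<in> {a..b}" for i
    using pos[of i] that by (auto simp: frac_le)
  have rest_nonneg: "0 \<le> (\<Sum>i\<in>I. 1 / real (x i))" for I
    by (simp add: sum_nonneg)
  show False
  proof (cases "z \<in> {a..b}")
    case False
    then have zm: "m \<le> z" using z by auto
    have "(\<Sum>i=1..k. 1 / real (k * m)) < (\<Sum>i=1..k. 1 / real (x i))"
    proof (rule sum_strict_mono)
      fix i assume i: "i \<in> {1..k}"
      have "x i < k * m"
        using mem[of i] i less_le_trans[OF bm mkm] by auto
      then show "1 / real (k * m) < 1 / real (x i)"
        using pos[of i] i k m by (intro divide_strict_left_mono mult_pos_pos) (auto simp del: of_nat_mult)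
    qed (use k in auto)
    also have "\<dots> = 1 / z" using eq by (simp add: z_def)
    also have "\<dots> \<le> 1 / m" using zm m by (simp add: frac_le)
    finally show False using k m by simp
  next
    case True
    then have zab: "a \<le> z" "z \<le> b" by auto
    define J where "J = {i \<in> {1..k}. x i \<in> {a..b}}"
    have finJ: "finite J" and JI: "J \<subseteq> {1..k}" by (auto simp: J_def)
    have split: "(\<Sum>i\<in>J. 1 / real (x i)) + (\<Sum>i\<in>{1..k} - J. 1 / real (x i)) = 1 / z"
      using eq sum.subset_diff[OF JI, of "\<lambda>i. 1 / real (x i)"] by (simp add: z_def)
    have rest: "(\<Sum>i\<in>{1..k} - J. 1 / real (x i)) \<le> real (k - card J) / m"
    proof -
      have "(\<Sum>i\<in>{1..k} - J. 1 / real (x i)) \<le> of_nat (card ({1..k} - J)) * (1 / m)"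
        by (rule sum_bounded_above) (auto simp: J_def intro!: upper)
      also have "card ({1..k} - J) = k - card J"
        using JI finJ by (simp add: card_Diff_subset)
      finally show ?thesis by simp
    qed
    consider "card J = 0" | "card J = 1" | "card J \<ge> 2" by linarith
    then show False
    proof cases
      case 1
      then have "1 / z \<le> k / m" using split rest finJ by simp
      then have "m \<le> k * z" using z m by (simp add: field_simps flip: of_nat_mult)
      also have "\<dots> \<le> k * b" using zab by simp
      finally show False using kb by simp
    next
      case 2
      then obtain i where J: "J = {i}" by (auto simp: card_1_singleton_iff)
      have "i \<in> J" using J by simp
      then have i: "i \<in> {1..k}" and xi: "x i \<le> b" and xpos: "0 < x i"
        using pos[of i] unfolding J_def by auto
      have eq': "1 / x i + (\<Sum>i\<in>{1..k} - J. 1 / real (x i)) = 1 / z"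
        using split J by simp
      \<comment> \<open>As \<open>k \<ge> 2\<close>, another positive term remains, hence
        \<open>x i > z \<ge> 1\<close>. So \<open>b \<ge> 2\<close>, and \<open>b * (b - 1)\<close>
        is nonzero.\<close>
      have "0 < (\<Sum>i\<in>{1..k} - J. 1 / real (x i))"
      proof (rule sum_pos)
        have "card ({1..k} - J) = k - 1" using 2 JI finJ by (simp add: card_Diff_subset)
        then have "card ({1..k} - J) \<noteq> 0" using k by simp
        then show "{1..k} - J \<noteq> {}" by (metis card.empty)
      qed (use pos in auto)
      then have "1 / real (x i) < 1 / real z" using eq' by linarith
      then have less: "z < x i" using z xpos by (simp add: field_simps)
      have "1 / real (b * (b - 1)) \<le> 1 / real (x i * (x i - 1))"
        using less z xi by (intro divide_left_mono) (auto intro!: mult_mono simp del: of_nat_mult)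
      also have "\<dots> = 1 / real (x i - 1) - 1 / real (x i)"
        using less z by (simp add: field_simps of_nat_diff)
      also have "\<dots> \<le> 1 / real z - 1 / real (x i)"
        using less z by (simp add: frac_le)
      also have "\<dots> \<le> real (k - 1) / m"
        using eq' rest 2 by simp
      finally have "m \<le> (k - 1) * (b * (b - 1))"
        using less z xi m by (simp add: divide_simps mult_ac flip: of_nat_mult split: if_splits)
      then show False using gap by (simp add: mult_ac)
    next
      case 3
      have b0: "0 < b" and a0: "0 < a" using z zab b by auto
      have J2: "card J * (1 / b) \<le> (\<Sum>i\<in>J. 1 / real (x i))"
        by (rule sum_bounded_below) (auto simp: J_def intro!: lower)
      have "1 / z \<le> 1 / a" using a0 zab by (simp add: frac_le)
      then have "card J * (1 / b) \<le> 1 / a"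
        using J2 split rest_nonneg[of "{1..k} - J"] by linarith
      then have "card J * a \<le> b" using a0 b0 by (simp add: field_simps flip: of_nat_mult)
      then have "card J \<le> 2 \<and> b = 2 * a"
        using 3 b a0 by (metis le_antisym mult_le_mono1 mult_le_cancel2 order.trans)
      then have k3: "k \<ge> 3" and cJ: "card J = 2" and bb: "b = 2 * a" using 3 strict by auto
      \<comment> \<open>The two short terms already sum to at least \<open>1 / a\<close>, the most
        that \<open>1 / z\<close> can be, so any third term overshoots. For \<open>k = 2\<close>
        there is none, whence the assumption \<open>strict\<close>.\<close>
      have "0 < (\<Sum>i\<in>{1..k} - J. 1 / real (x i))"
      proof (rule sum_pos)
        have "card ({1..k} - J) = k - 2" using cJ JI finJ by (simp add: card_Diff_subset)
        then have "card ({1..k} - J) \<noteq> 0" using k3 by simp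
        then show "{1..k} - J \<noteq> {}" by (metis card.empty)
      qed (use pos in auto)
      then have "card J * (1 / b) < 1 / a"
        using J2 split \<open>1 / z \<le> 1 / a\<close> by linarith
      then show False using cJ bb a0 by simp
    qed
  qed
qed

section \<open>The explicit colourings\<close>

lemma ex_consecutive_interval:
  fixes f :: "nat \<Rightarrow> nat"
  assumes "f 0 \<le> x" "x < f n"
  shows "\<exists>j<n. f j \<le> x \<and> x < f (Suc j)"
  using assms(2)
proof (induction n)
  case (Suc n)
  then show ?case by (cases "x < f n") (auto intro: less_SucI)
qed (use assms(1) in simp)

text \<open>For \<open>b = 2 ^ Suc j - 2\<close> this rearranges to
  \<open>(b - 1) * (k - 1) \<le> k ^ j\<close>, which together with \<open>b < M\<close> gives the
  gap condition. The excluded pair fails by one: 16 against 15.\<close>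

lemma two_power_times_le_power:
  fixes k j :: nat
  assumes k: "k \<ge> 3" and j: "j \<ge> 1" and kj: "\<not> (k = 3 \<and> j = 2)"
  shows "2 ^ Suc j * (k - 1) \<le> k ^ j + 3 * (k - 1)"
proof -
  obtain d where d: "k = d + 3" by (rule that[of "k - 3"]) (use k in simp)
  consider "j = 1" | "j = 2" | "j \<ge> 3" using j by linarith
  then show ?thesis
  proof cases
    case 1
    then show ?thesis by (simp add: d)
  next
    case 2
    with kj d have "d \<ge> 1" by auto
    then show ?thesis by (simp add: 2 d power2_eq_square distrib_left distrib_right)
  next
    case 3
    then show ?thesis
    proof (induction j rule: dec_induct)
      case base
      show ?case by (simp add: d power3_eq_cube distrib_left distrib_right)
    next
      case (step n)
      \<comment> \<open>Doubling the induction hypothesis leaves an excess of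
        \<open>3 * (k - 1)\<close>. The spare \<open>k ^ n\<close> in \<open>3 * k ^ n\<close>
        absorbs it, as the hypothesis also yields \<open>k ^ n \<ge> 13 * (k - 1)\<close>.\<close>
      have "2 ^ 4 \<le> (2::nat) ^ Suc n" using step by (intro power_increasing) auto
      then have "16 * (k - 1) \<le> 2 ^ Suc n * (k - 1)" by (intro mult_le_mono1) simp
      moreover have "3 * k ^ n \<le> k ^ Suc n" using k by simp
      moreover have "2 ^ Suc (Suc n) * (k - 1) = 2 * (2 ^ Suc n * (k - 1))" by simp
      ultimately show ?case using step.IH by linarith
    qed
  qed
qed

lemma unit_frac_rado_2_ge:
  assumes "r \<ge> 1"
  shows "2 ^ (r - 1 + r) \<le> unit_frac_rado r 2"
proof (rule unit_frac_rado_ge)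
  \<comment> \<open>For \<open>j = 0\<close> the exponent truncates and the short part
    \<open>{1..0}\<close> is empty. Block \<open>j\<close> stops below \<open>2 ^ j\<close>, so that
    the product in the gap condition stays below \<open>4 ^ j \<le> 2 ^ (r - 1 + j)\<close>.\<close>
  define A :: "nat \<Rightarrow> nat set" where
    "A j = {2 ^ (j - 1)..2 ^ j - 1} \<union> {2 ^ (r - 1 + j)..<2 * 2 ^ (r - 1 + j)}" for j
  show "\<exists>j<r. x \<in> A j" if x: "0 < x" "x < 2 ^ (r - 1 + r)" for x
  proof (cases "x < 2 ^ (r - 1)")
    case True
    then obtain j where "j < r - 1" "2 ^ j \<le> x" "x < 2 ^ Suc j"
      using ex_consecutive_interval[of "\<lambda>j. 2 ^ j" x "r - 1"] x by auto
    then show ?thesis by (intro exI[of _ "Suc j"]) (auto simp: A_def)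
  next
    case False
    then obtain j where "j < r" "2 ^ (r - 1 + j) \<le> x" "x < 2 ^ Suc (r - 1 + j)"
      using ex_consecutive_interval[of "\<lambda>j. 2 ^ (r - 1 + j)" x r] x by (metis add_0_right add_Suc_right not_less)
    then show ?thesis unfolding A_def Un_iff atLeastLessThan_iff power_Suc by blast
  qed
  show "unit_frac_free 2 (A j)" if j: "j < r" for j
    unfolding A_def
  proof (rule unit_frac_free_two_intervals)
    have dbl: "(2::nat) ^ j \<le> 2 * 2 ^ (j - 1)" by (cases j) auto
    then show "(2::nat) ^ j - 1 \<le> 2 * 2 ^ (j - 1)"
      "(3::nat) \<le> 2 \<or> (2::nat) ^ j - 1 < 2 * 2 ^ (j - 1)"
      by (auto simp: diff_less_mono2 intro: less_le_trans[of _ "2 ^ j"])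
    have pow: "(2::nat) ^ j * 2 ^ j \<le> 2 ^ (r - 1 + j)"
      using j by (simp flip: power_add)
    have "2 * (2 ^ j - 1) < (2::nat) ^ j * 2 ^ j"
    proof (cases j)
      case (Suc i)
      then have "2 \<le> (2::nat) ^ j" by simp
      then have "2 * 2 ^ j \<le> (2::nat) ^ j * 2 ^ j" by (rule mult_le_mono1)
      then show ?thesis using \<open>2 \<le> 2 ^ j\<close> by linarith
    qed simp
    then show "2 * (2 ^ j - 1) < (2::nat) ^ (r - 1 + j)" using pow by linarith
    have "(2 ^ j - 1) * (2 ^ j - 1 - 1) \<le> (2 ^ j - 1) * (2::nat) ^ j"
      by (intro mult_le_mono2) simp
    also have "\<dots> < 2 ^ j * 2 ^ j" by (intro mult_less_mono1) simp_all
    finally show "(2 ^ j - 1) * (2 ^ j - 1 - 1) * (2 - 1) < (2::nat) ^ (r - 1 + j)"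
      using pow by simp
  qed simp
qed simp

lemma unit_frac_rado_ge_3:
  assumes k: "k \<ge> 3"
  shows "(2 ^ r - 1) * k ^ r \<le> unit_frac_rado r k"
proof (rule unit_frac_rado_ge)
  define M :: nat where "M = 2 ^ r - 1"
  \<comment> \<open>The short part has \<open>b = 2 * a\<close> exactly, the extreme case allowed
    for \<open>k \<ge> 3\<close>. At \<open>j = 0\<close> it is \<open>{0}\<close>, which
    contributes no denominator.\<close>
  define A where "A j = {2 ^ j - 1..2 ^ Suc j - 2} \<union> {M * k ^ j..<k * (M * k ^ j)}" for j
  show "\<exists>j<r. x \<in> A j" if x: "0 < x" "x < (2 ^ r - 1) * k ^ r" for x
  proof (cases "x < M")
    case True
    then obtain j where "j < r" "2 ^ j - 1 \<le> x" "x < 2 ^ Suc j - 1"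
      using ex_consecutive_interval[of "\<lambda>j. 2 ^ j - 1" x r] by (auto simp: M_def)
    then show ?thesis by (intro exI[of _ j]) (auto simp: A_def)
  next
    case False
    then obtain j where "j < r" "M * k ^ j \<le> x" "x < M * k ^ Suc j"
      using ex_consecutive_interval[of "\<lambda>j. M * k ^ j" x r] x by (auto simp: M_def)
    then show ?thesis by (intro exI[of _ j]) (auto simp: A_def mult_ac)
  qed
  show "unit_frac_free k (A j)" if j: "j < r" for j
    unfolding A_def
  proof (rule unit_frac_free_two_intervals)
    let ?b = "2 ^ Suc j - 2 :: nat"
    have "(2::nat) ^ Suc j \<le> 2 ^ r" using j by (intro power_increasing) auto
    moreover have "(2::nat) \<le> 2 ^ Suc j" by simp
    ultimately have bM: "?b < M" unfolding M_def by linarith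
    show "k * ?b < M * k ^ j"
    proof (cases j)
      case 0
      then show ?thesis using bM by simp
    next
      case (Suc i)
      have "k * ?b < k * M" using bM k by simp
      also have "\<dots> \<le> k * M * k ^ i" using k by simp
      finally show ?thesis by (simp add: Suc mult_ac)
    qed
    show "?b * (?b - 1) * (k - 1) < M * k ^ j"
    proof (cases "j = 0")
      case True
      then show ?thesis using bM by simp
    next
      case False
      show ?thesis
      proof (cases "k = 3 \<and> j = 2")
        \<comment> \<open>Here \<open>b = 6\<close> and the left side is 60, while
          \<open>M > 6\<close> makes the right side at least \<open>7 * 9 = 63\<close>.\<close>
        case True
        then show ?thesis using bM by simp
      next
        case kj: False
        have "(?b - 1) * (k - 1) \<le> k ^ j"
          using two_power_times_le_power[OF k _ kj] False
          by (simp add: diff_mult_distrib)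
        then have "?b * ((?b - 1) * (k - 1)) \<le> ?b * k ^ j" by (rule mult_le_mono2)
        also have "\<dots> < M * k ^ j" using bM k by simp
        finally show ?thesis by (simp add: mult.assoc)
      qed
    qed
  qed (use k in auto)
qed (use k in simp)

theorem theorem1p1:
  shows "(\<forall>r::nat. r \<ge> 1 \<longrightarrow> real (unit_frac_rado r 2) \<ge> 4 ^ r / 2) \<and>
         (\<forall>k r::nat. k \<ge> 3 \<longrightarrow> r \<ge> 1 \<longrightarrow>
            real (unit_frac_rado r k) \<ge> (2 ^ r - 1) * real k ^ r)"
proof (intro conjI allI impI)
  fix r :: nat
  assume r: "r \<ge> 1"
  have "(4::real) ^ r = 2 ^ (r + r)"
    by (simp add: power_add flip: power_mult_distrib)
  also have "\<dots> = 2 * 2 ^ (r - 1 + r)"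
    using r by (simp flip: power_Suc)
  finally show "real (unit_frac_rado r 2) \<ge> 4 ^ r / 2"
    using of_nat_mono[OF unit_frac_rado_2_ge[OF r], where 'a = real] by simp
next
  fix k r :: nat
  assume "k \<ge> 3"
  from of_nat_mono[OF unit_frac_rado_ge_3[OF this, of r], where 'a = real]
  show "real (unit_frac_rado r k) \<ge> (2 ^ r - 1) * real k ^ r"
    by (simp add: of_nat_diff)
qed

end
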